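(* Let $A$ be a unital complete atomistic inverse $\wedge$-semigroup, let $T$ be an inverse semigroup and let $\rho\colon T\to A$ be a dispersed representation. Then $\rho$ is weakly equivalent to a Schein sum of weakly effective and weakly transitive representations in local algebras of $A$, and if $\rho$ is effective, each factor is transitive. That is, there are a family $(B_k)_{k\in K}$ of local algebras of $A$ and representations $\psi_k\colon T\to B_k$ $(k\in K)$, each weakly effective and weakly transitive in $B_k$, such that $\otimes\psi_k\colon T\to\prod_{k\in K} B_k$ is a Schein sum and $\rho$ is weakly equivalent to $\otimes\psi_k$; moreover, if $\rho$ is (strongly) effective in $A$, then each $\psi_k$ is (strongly) transitive in $B_k$.
   Context: Maps are written on the right. An inverse $\wedge$-semigroup is an inverse semigroup $A$ in which every two elements have a greatest lower bound $a\wedge b$ in the natural partial order ($a\le b$ iff $a=eb$ for some idempotent $e$). $A$ is complete if every non-empty subset has an infimum in the natural order; then $A$ has a bottom element $0=\inf A$, which is a multiplicative zero, and every subset that is bounded above has a supremum. $A$ is unital if it has an identity element $1_A$. $A$ is atomistic if every element is a supremum of atoms (atoms being the minimal non-zero elements). $P(A)$ denotes the set of atoms of the idempotent semilattice $E(A)$. A local algebra of $A$ is a subset $eAe$ with $e=e^2\in A$; it is itself a complete atomistic inverse $\wedge$-semigroup with identity $e$. "Subsemigroup" always means inverse subsemigroup. A representation of an inverse semigroup $T$ in $A$ is a semigroup homomorphism $T\to A$. Let $S$ be a subsemigroup of a unital complete atomistic inverse $\wedge$-semigroup $A$ and let $P=P(A)$. The relation $\mathcal{T}_S$ on $P$ is: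 $p\,\mathcal{T}_S\,q$ iff $q=s^{-1}ps$ for some $s\in S$ (equivalently $psq\neq0$ for some $s\in S$). It is symmetric and transitive, hence an equivalence on its domain $\{p\in P\colon ps\ne 0\text{ for some }s\in S\}$; the $\mathcal{T}_S$-classes are the classes into which this domain is partitioned, denoted $P_i$, $i\in I$. Put $e_i=\sup P_i$ and $A_i=e_iAe_i$. - $S$ is dispersed if $A_i\cap P_j\neq\varnothing$ implies $i=j$. - $S$ is weakly effective in $A$ if $S\subseteq eAe$ with $e=e^2\in A$ implies $e=1_A$. - $S$ is (strongly) effective in $A$ if there is no $p\in P$ with $ps=0$ for all $s\in S$. - $S$ is weakly transitive in $A$ if $\mathcal{T}_S$ has just one class, that is, for each pair $p,q\in P$ with $pS\neq\{0\}$ and $qS\neq\{0\}$, $p=s^{-1}qs$ for some $s\in S$. - $S$ is (strongly) transitive in $A$ if for all $p,q\in P$ there is $s\in S$ with $psq\neq0$. A representation has one of these properties if its image has it as a subsemigroup of the codomain (for codomain a local algebra $B$, the definitions are applied with $B$ in place of $A$). For subsemigroups $T_k\le A$ ($k\in K$), $\otimes t_k$ denotes the element $(t_k)_{k\in K}$ of $\prod T_k$; it is bounded if the set $\{t_k\colon k\in K\}$ is bounded above in $A$. The set $\mathscr{B}(\prod T_k)$ of bounded elements is an inverse subsemigroup of $\prod T_k$, and $\omega\colon\mathscr{B}(\prod T_k)\to A$ is the map $(\otimes t_k)\omega=\sup\{t_k\colon k\in K\}$ (with $\sup\varnothing=0$). A subsemigroup of $\mathscr{B}(\prod T_k)$ is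 a Schein sum if the restriction of $\omega$ to it is a homomorphism. Given homomorphisms $\psi_k\colon T\to T_k$, the map $\otimes\psi_k\colon T\to\prod T_k$ is $t\mapsto\otimes(t\psi_k)$; it is called a Schein sum if its image is contained in $\mathscr{B}(\prod T_k)$ and is a Schein sum; the $\psi_k$ are its factors. Representations $\phi$ and $\psi$ of $T$ (possibly with different codomains) are weakly equivalent if there is an isomorphism $\theta\colon T\phi\to T\psi$ between their images such that $\phi\theta=\psi$. *)

theory Defs
  imports "HOL-Algebra.Lattice" "HOL-Algebra.Product_Groups"
begin

text \<open>
  Semigroups are represented by the \<^typ>\<open>'a monoid\<close> records of HOL-Algebra, so that
  \<^const>\<open>hom\<close>, \<^const>\<open>iso\<close> and \<^const>\<open>product_group\<close> apply to them. The field \<^const>\<open>one\<close> carries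
  no meaning unless the structure satisfies \<^const>\<open>monoid\<close> or is a local algebra (below); none of
  \<^const>\<open>hom\<close>, \<^const>\<open>iso\<close> and the definitions below read it otherwise. A subsemigroup with underlying
  set \<open>S\<close> is the record \<open>A\<lparr>carrier := S\<rparr>\<close>.
  Maps are written on the left.
\<close>

section \<open>Inverse semigroups and their natural order\<close>

locale inverse_semigroup =
  fixes A (structure)
  assumes mult_closed: "\<lbrakk>x \<in> carrier A; y \<in> carrier A\<rbrakk> \<Longrightarrow> x \<otimes> y \<in> carrier A"
    and mult_assoc: "\<lbrakk>x \<in> carrier A; y \<in> carrier A; z \<in> carrier A\<rbrakk>
          \<Longrightarrow> (x \<otimes> y) \<otimes> z = x \<otimes> (y \<otimes> z)"
    and inverse_ex1: "x \<in> carrier A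
          \<Longrightarrow> \<exists>!y. y \<in> carrier A \<and> x \<otimes> y \<otimes> x = x \<and> y \<otimes> x \<otimes> y = y"

text \<open>
  The semigroup inverse; the notation \<open>inv\<close> of HOL-Algebra refers to two-sided inverses with
  respect to \<^const>\<open>one\<close> and is not what is meant here.
\<close>

definition sinv :: "('a, 'm) monoid_scheme \<Rightarrow> 'a \<Rightarrow> 'a" where
  "sinv A x = (THE y. y \<in> carrier A \<and> x \<otimes>\<^bsub>A\<^esub> y \<otimes>\<^bsub>A\<^esub> x = x \<and> y \<otimes>\<^bsub>A\<^esub> x \<otimes>\<^bsub>A\<^esub> y = y)"

definition idempotents :: "('a, 'm) monoid_scheme \<Rightarrow> 'a set" where
  "idempotents A = {e \<in> carrier A. e \<otimes>\<^bsub>A\<^esub> e = e}"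

definition inverse_subsemigroup :: "'a set \<Rightarrow> ('a, 'm) monoid_scheme \<Rightarrow> bool" where
  "inverse_subsemigroup S A \<longleftrightarrow> S \<subseteq> carrier A \<and>
     (\<forall>x\<in>S. \<forall>y\<in>S. x \<otimes>\<^bsub>A\<^esub> y \<in> S) \<and> (\<forall>x\<in>S. sinv A x \<in> S)"

definition nat_order :: "('a, 'm) monoid_scheme \<Rightarrow> 'a gorder" where
  "nat_order A = \<lparr>carrier = carrier A, eq = (=),
     le = (\<lambda>a b. \<exists>e\<in>idempotents A. a = e \<otimes>\<^bsub>A\<^esub> b)\<rparr>"

locale inverse_meet_semigroup = inverse_semigroup +
  assumes meet_exists: "\<lbrakk>x \<in> carrier A; y \<in> carrier A\<rbrakk> \<Longrightarrow> \<exists>m. is_glb (nat_order A) m {x, y}"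

definition nat_complete :: "('a, 'm) monoid_scheme \<Rightarrow> bool" where
  "nat_complete A \<longleftrightarrow>
     (\<forall>Y. Y \<subseteq> carrier A \<and> Y \<noteq> {} \<longrightarrow> (\<exists>m. is_glb (nat_order A) m Y))"

definition zero_elem :: "('a, 'm) monoid_scheme \<Rightarrow> 'a" where
  "zero_elem A = \<Sqinter>\<^bsub>nat_order A\<^esub> (carrier A)"

definition order_atoms :: "'a gorder \<Rightarrow> 'a set" where
  "order_atoms L = {a \<in> carrier L. a \<noteq> \<bottom>\<^bsub>L\<^esub> \<and>
     (\<forall>b\<in>carrier L. b \<noteq> \<bottom>\<^bsub>L\<^esub> \<and> b \<sqsubseteq>\<^bsub>L\<^esub> a \<longrightarrow> b = a)}"

definition nat_atomistic :: "('a, 'm) monoid_scheme \<Rightarrow> bool" where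
  "nat_atomistic A \<longleftrightarrow>
     (\<forall>x\<in>carrier A. \<exists>Y. Y \<subseteq> order_atoms (nat_order A) \<and> is_lub (nat_order A) x Y)"

definition idem_atoms :: "('a, 'm) monoid_scheme \<Rightarrow> 'a set" where
  "idem_atoms A = order_atoms ((nat_order A)\<lparr>carrier := idempotents A\<rparr>)"

definition local_algebra :: "('a, 'm) monoid_scheme \<Rightarrow> 'a \<Rightarrow> ('a, 'm) monoid_scheme" where
  "local_algebra A e = A\<lparr>carrier := {e \<otimes>\<^bsub>A\<^esub> x \<otimes>\<^bsub>A\<^esub> e | x. x \<in> carrier A}, one := e\<rparr>"

section \<open>Properties of a subsemigroup \<open>S\<close> of \<open>A\<close>\<close>

definition trans_rel :: "('a, 'm) monoid_scheme \<Rightarrow> 'a set \<Rightarrow> ('a \<times> 'a) set" where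
  "trans_rel A S = {(p, q). p \<in> idem_atoms A \<and> q \<in> idem_atoms A \<and>
     (\<exists>s\<in>S. q = sinv A s \<otimes>\<^bsub>A\<^esub> p \<otimes>\<^bsub>A\<^esub> s)}"

definition trans_classes :: "('a, 'm) monoid_scheme \<Rightarrow> 'a set \<Rightarrow> 'a set set" where
  "trans_classes A S =
     {p \<in> idem_atoms A. \<exists>s\<in>S. p \<otimes>\<^bsub>A\<^esub> s \<noteq> zero_elem A} // trans_rel A S"

definition dispersed :: "('a, 'm) monoid_scheme \<Rightarrow> 'a set \<Rightarrow> bool" where
  "dispersed A S \<longleftrightarrow> (\<forall>C\<in>trans_classes A S. \<forall>D\<in>trans_classes A S.
     carrier (local_algebra A (\<Squnion>\<^bsub>nat_order A\<^esub> C)) \<inter> D \<noteq> {} \<longrightarrow> C = D)"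

definition weakly_effective :: "('a, 'm) monoid_scheme \<Rightarrow> 'a set \<Rightarrow> bool" where
  "weakly_effective A S \<longleftrightarrow>
     (\<forall>e\<in>idempotents A. S \<subseteq> carrier (local_algebra A e) \<longrightarrow> e = \<one>\<^bsub>A\<^esub>)"

definition strongly_effective :: "('a, 'm) monoid_scheme \<Rightarrow> 'a set \<Rightarrow> bool" where
  "strongly_effective A S \<longleftrightarrow>
     \<not> (\<exists>p\<in>idem_atoms A. \<forall>s\<in>S. p \<otimes>\<^bsub>A\<^esub> s = zero_elem A)"

definition weakly_transitive :: "('a, 'm) monoid_scheme \<Rightarrow> 'a set \<Rightarrow> bool" where
  "weakly_transitive A S \<longleftrightarrow> (\<exists>!C. C \<in> trans_classes A S)"

definition strongly_transitive :: "('a, 'm) monoid_scheme \<Rightarrow> 'a set \<Rightarrow> bool" where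
  "strongly_transitive A S \<longleftrightarrow> (\<forall>p\<in>idem_atoms A. \<forall>q\<in>idem_atoms A.
     \<exists>s\<in>S. p \<otimes>\<^bsub>A\<^esub> s \<otimes>\<^bsub>A\<^esub> q \<noteq> zero_elem A)"

section \<open>Schein sums\<close>

text \<open>
  \<open>Tk k\<close> is the underlying set of the \<open>k\<close>-th subsemigroup of \<open>A\<close>. The empty family is
  bounded above (\<open>A\<close> being non-empty), and its supremum is the bottom element.
\<close>

definition bounded_product ::
    "('a, 'm) monoid_scheme \<Rightarrow> 'k set \<Rightarrow> ('k \<Rightarrow> 'a set) \<Rightarrow> ('k \<Rightarrow> 'a) monoid" where
  "bounded_product A K Tk = (product_group K (\<lambda>k. A\<lparr>carrier := Tk k\<rparr>))
     \<lparr>carrier := {x \<in> (\<Pi>\<^sub>E k\<in>K. Tk k). Upper (nat_order A) (x ` K) \<noteq> {}}\<rparr>"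

definition schein_omega :: "('a, 'm) monoid_scheme \<Rightarrow> 'k set \<Rightarrow> ('k \<Rightarrow> 'a) \<Rightarrow> 'a" where
  "schein_omega A K x = \<Squnion>\<^bsub>nat_order A\<^esub> (x ` K)"

definition schein_sum ::
    "('a, 'm) monoid_scheme \<Rightarrow> 'k set \<Rightarrow> ('k \<Rightarrow> 'a set) \<Rightarrow> ('k \<Rightarrow> 'a) set \<Rightarrow> bool" where
  "schein_sum A K Tk U \<longleftrightarrow> inverse_subsemigroup U (bounded_product A K Tk) \<and>
     schein_omega A K \<in> hom ((bounded_product A K Tk)\<lparr>carrier := U\<rparr>) A"

definition otimes_map :: "'k set \<Rightarrow> ('k \<Rightarrow> 't \<Rightarrow> 'a) \<Rightarrow> 't \<Rightarrow> 'k \<Rightarrow> 'a" where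
  "otimes_map K \<psi> t = (\<lambda>k\<in>K. \<psi> k t)"

definition schein_sum_map :: "('t, 'n) monoid_scheme \<Rightarrow> ('a, 'm) monoid_scheme
    \<Rightarrow> 'k set \<Rightarrow> ('k \<Rightarrow> 'a set) \<Rightarrow> ('k \<Rightarrow> 't \<Rightarrow> 'a) \<Rightarrow> bool" where
  "schein_sum_map T A K Tk \<psi> \<longleftrightarrow>
     otimes_map K \<psi> ` carrier T \<subseteq> carrier (bounded_product A K Tk) \<and>
     schein_sum A K Tk (otimes_map K \<psi> ` carrier T)"

definition weakly_equivalent :: "('t, 'n) monoid_scheme
    \<Rightarrow> ('a, 'm) monoid_scheme \<Rightarrow> ('t \<Rightarrow> 'a) \<Rightarrow> ('b, 'l) monoid_scheme \<Rightarrow> ('t \<Rightarrow> 'b) \<Rightarrow> bool" where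
  "weakly_equivalent T A \<phi> B \<psi> \<longleftrightarrow>
     (\<exists>\<theta> \<in> iso (A\<lparr>carrier := \<phi> ` carrier T\<rparr>) (B\<lparr>carrier := \<psi> ` carrier T\<rparr>).
        \<forall>t\<in>carrier T. \<theta> (\<phi> t) = \<psi> t)"

end

theory Submission
  imports Defs
begin

text \<open>
  Let \<open>S\<close> be the image of \<open>\<rho>\<close>. The factors of \<open>\<rho>\<close> are cut out by the suprema \<open>e\<^sub>C\<close> of the
  \<open>\<T>\<^sub>S\<close>-classes \<open>C\<close>: the factor at \<open>C\<close> is \<open>t \<mapsto> e\<^sub>C \<otimes> \<rho> t\<close>, with values in the local algebra
  at \<open>e\<^sub>C\<close>.

  This is a homomorphism because \<open>e\<^sub>C\<close> commutes with \<open>S\<close>, and that is where dispersedness enters.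
  The semilattice of idempotents need not be distributive, so the supremum \<open>e\<^sub>C\<close> might lie above
  atoms that do not belong to \<open>C\<close>. Dispersedness says that among the atoms that \<open>S\<close> does not
  annihilate this does not happen (\<open>mem_class_iff\<close>). An atom below \<open>e\<^sub>C \<otimes> (s \<otimes> s\<inverse>)\<close> is one of
  those, so it lies in \<open>C\<close>; then its conjugate by \<open>s\<close> lies in \<open>C\<close> as well, hence below \<open>e\<^sub>C\<close>,
  and conjugating back puts the atom below \<open>s \<otimes> e\<^sub>C \<otimes> s\<inverse>\<close>. As \<open>A\<close> is atomistic,
  \<open>e\<^sub>C \<otimes> (s \<otimes> s\<inverse>) \<le> s \<otimes> e\<^sub>C \<otimes> s\<inverse>\<close>, which amounts to \<open>e\<^sub>C \<otimes> s = e\<^sub>C \<otimes> s \<otimes> e\<^sub>C\<close>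
  (\<open>class_sup_mult_sandwich\<close>); together with the same for \<open>s\<inverse>\<close> this makes \<open>e\<^sub>C\<close> central
  (\<open>class_sup_central\<close>).

  Each \<open>s\<close> in \<open>S\<close> is the supremum of its components \<open>e\<^sub>C \<otimes> s\<close> (\<open>lub_components\<close>): an upper bound
  may be replaced by its meet with \<open>s\<close>, and the range idempotent of that meet lies above every atom
  below \<open>s \<otimes> s\<inverse>\<close>, each of which belongs to some class. So \<open>\<omega>\<close> sends the tuple of the components
  of \<open>\<rho> t\<close> back to \<open>\<rho> t\<close>, which yields the Schein sum and the weak equivalence at once.

  Within the local algebra at \<open>e\<^sub>C\<close>, the atoms not annihilated by the factor are exactly
  those of \<open>C\<close>, and they form a single class (\<open>trans_classes_component\<close>); since \<open>e\<^sub>C\<close> is their supremum, the factor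
  fits in no smaller local algebra (\<open>weakly_effective_component\<close>). If \<open>\<rho>\<close> is effective, every atom
  below \<open>e\<^sub>C\<close> belongs to \<open>C\<close>, and the factor is transitive.
\<close>

section \<open>Inverse semigroups\<close>

context inverse_semigroup
begin

abbreviation nat_le :: "'a \<Rightarrow> 'a \<Rightarrow> bool"  (infix \<open>\<preceq>\<close> 50) where
  "a \<preceq> b \<equiv> a \<sqsubseteq>\<^bsub>nat_order A\<^esub> b"

abbreviation E :: "'a set" where
  "E \<equiv> idempotents A"

lemma idem_closed [simp]: "e \<in> E \<Longrightarrow> e \<in> carrier A"
  and idem_idem [simp]: "e \<in> E \<Longrightarrow> e \<otimes> e = e"
  by (auto simp: idempotents_def)

lemma idemI: "\<lbrakk>e \<in> carrier A; e \<otimes> e = e\<rbrakk> \<Longrightarrow> e \<in> E"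
  unfolding idempotents_def by blast

lemma idem_idem_left [simp]: "\<lbrakk>e \<in> E; x \<in> carrier A\<rbrakk> \<Longrightarrow> e \<otimes> (e \<otimes> x) = e \<otimes> x"
  by (simp add: mult_assoc[symmetric])

lemma sinv_props:
  assumes "x \<in> carrier A"
  shows "sinv A x \<in> carrier A \<and> x \<otimes> sinv A x \<otimes> x = x \<and> sinv A x \<otimes> x \<otimes> sinv A x = sinv A x"
  unfolding sinv_def by (rule theI') (rule inverse_ex1[OF assms])

lemma sinv_closed [simp]: "x \<in> carrier A \<Longrightarrow> sinv A x \<in> carrier A"
  using sinv_props by blast

lemma sinv_unique:
  assumes "x \<in> carrier A" "y \<in> carrier A" "x \<otimes> y \<otimes> x = x" "y \<otimes> x \<otimes> y = y"
  shows "sinv A x = y"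
  using inverse_ex1[OF assms(1)] sinv_props[OF assms(1)] assms by blast

declare mult_closed [simp] mult_assoc [simp]

lemma mult_sinv_mult [simp]: "x \<in> carrier A \<Longrightarrow> x \<otimes> (sinv A x \<otimes> x) = x"
  and sinv_mult_sinv [simp]: "x \<in> carrier A \<Longrightarrow> sinv A x \<otimes> (x \<otimes> sinv A x) = sinv A x"
  using sinv_props[of x] by simp_all

lemma mult_sinv_mult_left [simp]:
  assumes "x \<in> carrier A" "y \<in> carrier A"
  shows "x \<otimes> (sinv A x \<otimes> (x \<otimes> y)) = x \<otimes> y"
proof -
  have "x \<otimes> (sinv A x \<otimes> x) \<otimes> y = x \<otimes> y"
    using assms by (subst mult_sinv_mult) simp_all
  then show ?thesis
    using assms by (simp del: mult_sinv_mult)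
qed

lemma sinv_mult_sinv_left [simp]:
  assumes "x \<in> carrier A" "y \<in> carrier A"
  shows "sinv A x \<otimes> (x \<otimes> (sinv A x \<otimes> y)) = sinv A x \<otimes> y"
proof -
  have "sinv A x \<otimes> (x \<otimes> sinv A x) \<otimes> y = sinv A x \<otimes> y"
    using assms by (subst sinv_mult_sinv) simp_all
  then show ?thesis
    using assms by (simp del: sinv_mult_sinv)
qed

lemma sinv_sinv [simp]: "x \<in> carrier A \<Longrightarrow> sinv A (sinv A x) = x"
  by (rule sinv_unique) simp_all

lemma sinv_idem [simp]: "e \<in> E \<Longrightarrow> sinv A e = e"
  by (rule sinv_unique) simp_all

lemma range_idem [simp]: "x \<in> carrier A \<Longrightarrow> x \<otimes> sinv A x \<in> E"
  and domain_idem [simp]: "x \<in> carrier A \<Longrightarrow> sinv A x \<otimes> x \<in> E"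
  by (intro idemI; simp)+

text \<open>
  If \<open>x\<close> is the inverse of \<open>e \<otimes> f\<close>, so is \<open>f \<otimes> x \<otimes> e\<close>, which is idempotent; hence \<open>x\<close>, and
  with it \<open>e \<otimes> f\<close>, is idempotent.
\<close>

lemma idem_mult [simp]:
  assumes e: "e \<in> E" and f: "f \<in> E"
  shows "e \<otimes> f \<in> E"
proof -
  define x where "x = sinv A (e \<otimes> f)"
  have [simp]: "x \<in> carrier A" "e \<in> carrier A" "f \<in> carrier A"
    using assms by (simp_all add: x_def)
  have 1: "e \<otimes> (f \<otimes> (x \<otimes> (e \<otimes> f))) = e \<otimes> f" and 2: "x \<otimes> (e \<otimes> (f \<otimes> x)) = x"
    using sinv_props[of "e \<otimes> f"] by (simp_all add: x_def[symmetric])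
  have 3: "x \<otimes> (e \<otimes> (f \<otimes> (x \<otimes> y))) = x \<otimes> y" if "y \<in> carrier A" for y
    using arg_cong[OF 2, of "\<lambda>w. w \<otimes> y"] that by simp
  have x: "x = f \<otimes> (x \<otimes> e)"
    unfolding x_def by (rule sinv_unique) (simp_all add: e f 1 3 flip: x_def)
  have "x \<otimes> x = f \<otimes> (x \<otimes> e) \<otimes> (f \<otimes> (x \<otimes> e))"
    using x by simp
  also have "\<dots> = x"
    by (simp add: 3) (simp flip: x)
  finally have "x \<in> E"
    by (rule idemI[rotated]) simp
  then have "sinv A x \<in> E"
    by simp
  then show ?thesis
    by (simp add: x_def)
qed

lemma idem_mult_idem_mult [simp]:
  "\<lbrakk>e \<in> E; f \<in> E\<rbrakk> \<Longrightarrow> e \<otimes> (f \<otimes> (e \<otimes> f)) = e \<otimes> f"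
  using idem_idem[of "e \<otimes> f"] by (simp del: idem_idem)

lemma idem_commute:
  assumes e: "e \<in> E" and f: "f \<in> E"
  shows "e \<otimes> f = f \<otimes> e"
proof -
  have "sinv A (e \<otimes> f) = f \<otimes> e"
    using assms by (intro sinv_unique) simp_all
  then show ?thesis
    using assms by simp
qed

lemma idem_left_commute:
  "\<lbrakk>e \<in> E; f \<in> E; x \<in> carrier A\<rbrakk> \<Longrightarrow> e \<otimes> (f \<otimes> x) = f \<otimes> (e \<otimes> x)"
  by (metis idem_closed idem_commute mult_assoc)

text \<open>
  As rewrite rules these push idempotents to the left past the range idempotents \<open>x \<otimes> sinv A x\<close>
  and the domain idempotents \<open>sinv A x \<otimes> x\<close>, so that the latter can be absorbed.
\<close>

lemma range_commute [simp]:
    "\<lbrakk>e \<in> E; x \<in> carrier A\<rbrakk> \<Longrightarrow> x \<otimes> (sinv A x \<otimes> e) = e \<otimes> (x \<otimes> sinv A x)"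
  and domain_commute [simp]:
    "\<lbrakk>e \<in> E; x \<in> carrier A\<rbrakk> \<Longrightarrow> sinv A x \<otimes> (x \<otimes> e) = e \<otimes> (sinv A x \<otimes> x)"
  and range_left_commute [simp]:
    "\<lbrakk>e \<in> E; x \<in> carrier A; y \<in> carrier A\<rbrakk>
      \<Longrightarrow> x \<otimes> (sinv A x \<otimes> (e \<otimes> y)) = e \<otimes> (x \<otimes> (sinv A x \<otimes> y))"
  using idem_commute[of "x \<otimes> sinv A x" e] idem_commute[of "sinv A x \<otimes> x" e]
    idem_left_commute[of "x \<otimes> sinv A x" e y]
  by simp_all

text \<open>
  This joins the results of rewriting \<open>x \<otimes> (sinv A x \<otimes> (x \<otimes> e))\<close> by \<open>mult_sinv_mult_left\<close> and
  by \<open>domain_commute\<close>.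
\<close>

lemma mult_idem_domain [simp]:
    "\<lbrakk>e \<in> E; x \<in> carrier A\<rbrakk> \<Longrightarrow> x \<otimes> (e \<otimes> (sinv A x \<otimes> x)) = x \<otimes> e"
  using mult_sinv_mult_left[of x e]
  by (simp_all del: mult_sinv_mult_left)

text \<open>
  The two idempotents \<open>y \<otimes> sinv A y\<close> and \<open>sinv A x \<otimes> x\<close> meet in the middle of the product; they
  commute, and each is then absorbed.
\<close>

lemma sinv_mult:
  assumes x: "x \<in> carrier A" and y: "y \<in> carrier A"
  shows "sinv A (x \<otimes> y) = sinv A y \<otimes> sinv A x"
proof (rule sinv_unique)
  have c: "y \<otimes> (sinv A y \<otimes> (sinv A x \<otimes> (x \<otimes> z))) = sinv A x \<otimes> (x \<otimes> (y \<otimes> (sinv A y \<otimes> z)))"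
    if "z \<in> carrier A" for z
    using idem_left_commute[of "y \<otimes> sinv A y" "sinv A x \<otimes> x" z] x y that by simp
  show "x \<otimes> y \<otimes> (sinv A y \<otimes> sinv A x) \<otimes> (x \<otimes> y) = x \<otimes> y"
    using x y by (simp add: c)
  show "sinv A y \<otimes> sinv A x \<otimes> (x \<otimes> y) \<otimes> (sinv A y \<otimes> sinv A x) = sinv A y \<otimes> sinv A x"
    using x y by (simp flip: c)
qed (use x y in simp_all)

lemma conj_idem [simp]:
  assumes "x \<in> carrier A" "e \<in> E"
  shows "sinv A x \<otimes> (e \<otimes> x) \<in> E"
  using assms by (intro idemI) simp_all

lemma conj_idem' [simp]: "\<lbrakk>x \<in> carrier A; e \<in> E\<rbrakk> \<Longrightarrow> x \<otimes> (e \<otimes> sinv A x) \<in> E"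
  using conj_idem[of "sinv A x" e] by simp

text \<open>
  The idempotent witnessing \<open>a \<preceq> b\<close> can always be chosen as \<open>a \<otimes> sinv A a\<close>.
\<close>

lemma nat_le_iff:
  assumes "b \<in> carrier A"
  shows "a \<preceq> b \<longleftrightarrow> a \<in> carrier A \<and> a = a \<otimes> (sinv A a \<otimes> b)"
proof
  assume "a \<preceq> b"
  then obtain e where e: "e \<in> E" "a = e \<otimes> b"
    by (auto simp: nat_order_def)
  have "a \<otimes> (sinv A a \<otimes> b) = e \<otimes> (b \<otimes> sinv A b) \<otimes> (e \<otimes> b)"
    using e assms by (simp add: sinv_mult)
  also have "\<dots> = e \<otimes> b"
    using idem_left_commute[of "b \<otimes> sinv A b" e b] e assms by simp
  finally show "a \<in> carrier A \<and> a = a \<otimes> (sinv A a \<otimes> b)"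
    using e assms by simp
next
  assume a: "a \<in> carrier A \<and> a = a \<otimes> (sinv A a \<otimes> b)"
  then have "a = a \<otimes> sinv A a \<otimes> b"
    using assms by simp
  then show "a \<preceq> b"
    using a range_idem[of a] unfolding nat_order_def by auto
qed

lemma nat_leI: "\<lbrakk>e \<in> E; b \<in> carrier A\<rbrakk> \<Longrightarrow> e \<otimes> b \<preceq> b"
  by (auto simp: nat_order_def)

lemma idem_le_iff: "\<lbrakk>e \<in> E; f \<in> E\<rbrakk> \<Longrightarrow> e \<preceq> f \<longleftrightarrow> e \<otimes> f = e"
  by (subst nat_le_iff) auto

lemma le_idem_imp_idem: "\<lbrakk>a \<preceq> f; f \<in> E\<rbrakk> \<Longrightarrow> a \<in> E"
  by (auto simp: nat_order_def)

lemma carrier_nat_order [simp]: "carrier (nat_order A) = carrier A"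
  and eq_nat_order [simp]: "(.=\<^bsub>nat_order A\<^esub>) = (=)"
  by (simp_all add: nat_order_def)

sublocale nat: partial_order "nat_order A"
proof
  fix x y z
  assume "x \<in> carrier (nat_order A)"
  then show "x \<preceq> x"
    by (simp add: nat_le_iff)
next
  fix x y z
  assume xy: "x \<preceq> y" and yz: "y \<preceq> z"
    and c: "x \<in> carrier (nat_order A)" "y \<in> carrier (nat_order A)" "z \<in> carrier (nat_order A)"
  from xy yz obtain e f where "e \<in> E" "x = e \<otimes> y" "f \<in> E" "y = f \<otimes> z"
    by (auto simp: nat_order_def)
  then show "x \<preceq> z"
    using nat_leI[of "e \<otimes> f" z] c by simp
next
  fix x y
  assume xy: "x \<preceq> y" and yx: "y \<preceq> x"
    and c: "x \<in> carrier (nat_order A)" "y \<in> carrier (nat_order A)"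
  from xy yx obtain e f where e: "e \<in> E" "x = e \<otimes> y" and f: "f \<in> E" "y = f \<otimes> x"
    by (auto simp: nat_order_def)
  have "f \<otimes> y = y"
    using f c by simp
  have "y = f \<otimes> (e \<otimes> y)"
    unfolding e(2)[symmetric] by (rule f(2))
  also have "\<dots> = e \<otimes> (f \<otimes> y)"
    using e f c by (intro idem_left_commute) simp_all
  finally show "x .=\<^bsub>nat_order A\<^esub> y"
    using e(2) \<open>f \<otimes> y = y\<close> by simp
qed auto

lemma sup_eq: "is_lub (nat_order A) x X \<Longrightarrow> \<Squnion>\<^bsub>nat_order A\<^esub> X = x"
  unfolding sup_def by (blast intro: nat.least_unique some_equality)

lemma zero_elem_eqI:
  assumes z: "z \<in> carrier A" "\<And>x. x \<in> carrier A \<Longrightarrow> z \<preceq> x"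
  shows "zero_elem A = z"
proof -
  have "is_glb (nat_order A) z (carrier A)"
    using z by (auto simp: greatest_def Lower_def)
  then show ?thesis
    unfolding zero_elem_def inf_def by (blast intro: nat.greatest_unique some_equality)
qed

end

section \<open>Zeros and atoms\<close>

locale inverse_semigroup_zero = inverse_semigroup +
  assumes zero_closed [simp]: "zero_elem A \<in> carrier A"
    and zero_mult [simp]: "x \<in> carrier A \<Longrightarrow> zero_elem A \<otimes> x = zero_elem A"
    and mult_zero [simp]: "x \<in> carrier A \<Longrightarrow> x \<otimes> zero_elem A = zero_elem A"

text \<open>
  A bottom element \<open>z\<close> is idempotent, being below the idempotent \<open>z \<otimes> sinv A z\<close>, and it absorbs
  every idempotent. It is also below \<open>sinv A x\<close>, so it factors as \<open>g \<otimes> sinv A x\<close>; hence \<open>z \<otimes> x\<close> is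
  the product of \<open>z\<close> and the idempotent \<open>g \<otimes> (sinv A x \<otimes> x)\<close>.
\<close>

lemma (in inverse_semigroup) inverse_semigroup_zeroI:
  assumes z: "z \<in> carrier A" "\<And>x. x \<in> carrier A \<Longrightarrow> z \<preceq> x"
  shows "inverse_semigroup_zero A"
proof -
  have "zero_elem A = z"
    using z by (rule zero_elem_eqI)
  have zE: "z \<in> E"
    by (rule le_idem_imp_idem[of _ "z \<otimes> sinv A z"]) (simp_all add: z)
  have right: "z \<otimes> x = z" if x: "x \<in> carrier A" for x
  proof -
    have "sinv A x \<in> carrier A"
      using x by simp
    then have "z \<preceq> sinv A x"
      by (rule z(2))
    then obtain g where g: "g \<in> E" and zg: "z = g \<otimes> sinv A x"
      by (auto simp: nat_order_def)
    have le: "z \<otimes> f = z" if "f \<in> E" for f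
      using z(2)[of f] zE that by (simp add: idem_le_iff)
    have zx: "z \<otimes> x = g \<otimes> (sinv A x \<otimes> x)"
      by (subst zg) (use g x in simp)
    have "z \<otimes> x = z \<otimes> (z \<otimes> x)"
      using zE x by simp
    also have "\<dots> = z \<otimes> (g \<otimes> (sinv A x \<otimes> x))"
      unfolding zx ..
    also have "\<dots> = z"
      using le[of "g \<otimes> (sinv A x \<otimes> x)"] g x by simp
    finally show ?thesis .
  qed
  have left: "x \<otimes> z = z" if x: "x \<in> carrier A" for x
  proof -
    have "x \<otimes> z = sinv A (z \<otimes> sinv A x)"
      using x z zE by (simp add: sinv_mult)
    then show ?thesis
      using right[of "sinv A x"] x zE by simp
  qed
  show ?thesis
    by unfold_locales (simp_all add: \<open>zero_elem A = z\<close> z left right)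
qed

context inverse_semigroup_zero
begin

abbreviation Z :: 'a where
  "Z \<equiv> zero_elem A"

abbreviation P :: "'a set" where
  "P \<equiv> idem_atoms A"

lemma zero_idem [simp]: "Z \<in> E"
  by (intro idemI) simp_all

lemma zero_le: "x \<in> carrier A \<Longrightarrow> Z \<preceq> x"
  by (metis nat_leI zero_idem zero_mult)

lemma bottom_nat_order: "\<bottom>\<^bsub>nat_order A\<^esub> = Z"
proof -
  have "least (nat_order A) Z (carrier A)"
    by (simp add: least_def zero_le)
  then show ?thesis
    unfolding bottom_def carrier_nat_order
    by (intro some_equality nat.least_unique[where A = "carrier A"])
qed

lemma bottom_idempotents: "\<bottom>\<^bsub>(nat_order A)\<lparr>carrier := E\<rparr>\<^esub> = Z"
  unfolding bottom_def
proof (rule some_equality)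
  show "least ((nat_order A)\<lparr>carrier := E\<rparr>) Z (carrier ((nat_order A)\<lparr>carrier := E\<rparr>))"
    by (simp add: least_def zero_le)
next
  fix x
  assume "least ((nat_order A)\<lparr>carrier := E\<rparr>) x (carrier ((nat_order A)\<lparr>carrier := E\<rparr>))"
  then have "x \<in> E" "x \<preceq> Z"
    by (simp_all add: least_def)
  then show "x = Z"
    by (simp add: idem_le_iff)
qed

lemma idem_atoms_eq: "P = {p \<in> E. p \<noteq> Z \<and> (\<forall>f\<in>E. f \<noteq> Z \<and> f \<otimes> p = f \<longrightarrow> f = p)}"
  unfolding idem_atoms_def order_atoms_def bottom_idempotents
  by (auto simp: idem_le_iff)

lemma atomI:
  assumes "p \<in> E" "p \<noteq> Z" and min: "\<And>f. \<lbrakk>f \<in> E; f \<noteq> Z; f \<otimes> p = f\<rbrakk> \<Longrightarrow> f = p"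
  shows "p \<in> P"
  unfolding idem_atoms_eq
  by (intro CollectI conjI ballI impI min) (use assms(1,2) in simp_all)

lemma atom_idem [simp]: "p \<in> P \<Longrightarrow> p \<in> E"
  and atom_nonzero: "p \<in> P \<Longrightarrow> p \<noteq> Z"
  and atom_minimal: "\<lbrakk>p \<in> P; f \<in> E; f \<noteq> Z; f \<otimes> p = f\<rbrakk> \<Longrightarrow> f = p"
  by (simp_all add: idem_atoms_eq)

lemma atom_le_idem:
  assumes "p \<in> P" "f \<in> E" "p \<otimes> f \<noteq> Z"
  shows "p \<otimes> f = p"
proof -
  have "p \<otimes> f \<otimes> p = p \<otimes> f"
    using assms(1,2) by (simp add: idem_commute[of f p])
  then show ?thesis
    using assms by (metis atom_idem atom_minimal idem_mult)
qed

lemma atom_below_range: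
  assumes p: "p \<in> P" and s: "s \<in> carrier A" and "p \<otimes> s \<noteq> Z"
  shows "p \<otimes> (s \<otimes> sinv A s) = p"
proof (rule atom_le_idem[OF p])
  show "p \<otimes> (s \<otimes> sinv A s) \<noteq> Z"
  proof
    assume "p \<otimes> (s \<otimes> sinv A s) = Z"
    then have "p \<otimes> (s \<otimes> sinv A s) \<otimes> s = Z"
      using s by simp
    then show False
      using assms by simp
  qed
qed (use s in simp)

text \<open>
  Conjugation loses nothing: multiplying the conjugate by \<open>s\<close> on the left gives back \<open>p \<otimes> s\<close>.
\<close>

lemma conj_nonzero:
  assumes p: "p \<in> P" and s: "s \<in> carrier A"
  shows "sinv A s \<otimes> (p \<otimes> s) \<noteq> Z \<longleftrightarrow> p \<otimes> s \<noteq> Z"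
proof -
  have "p \<otimes> s = Z" if "sinv A s \<otimes> (p \<otimes> s) = Z"
  proof -
    have "p \<otimes> s = s \<otimes> (sinv A s \<otimes> (p \<otimes> s))"
      using p s by simp
    also have "\<dots> = Z"
      unfolding that using s by simp
    finally show ?thesis .
  qed
  then show ?thesis
    using s by auto
qed

lemma conj_conj:
  assumes "p \<in> P" "s \<in> carrier A" "p \<otimes> s \<noteq> Z"
  shows "s \<otimes> (sinv A s \<otimes> (p \<otimes> (s \<otimes> sinv A s))) = p"
  using atom_below_range[OF assms] assms by simp

text \<open>
  Conjugation by \<open>s\<close> carries the idempotents below \<open>s \<otimes> sinv A s\<close> isomorphically onto those
  below \<open>sinv A s \<otimes> s\<close>, so it preserves atoms.
\<close>

lemma conj_atom:
  assumes p: "p \<in> P" and s: "s \<in> carrier A" and ps: "p \<otimes> s \<noteq> Z"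
  shows "sinv A s \<otimes> (p \<otimes> s) \<in> P"
proof -
  let ?q = "sinv A s \<otimes> (p \<otimes> s)"
  have "f = ?q" if f: "f \<in> E" "f \<noteq> Z" "f \<otimes> ?q = f" for f
  proof -
    have qf: "sinv A s \<otimes> (p \<otimes> (s \<otimes> f)) = f"
      using f idem_commute[of ?q f] p s by simp
    have "sinv A s \<otimes> (s \<otimes> f) = sinv A s \<otimes> (s \<otimes> (sinv A s \<otimes> (p \<otimes> (s \<otimes> f))))"
      unfolding qf ..
    also have "\<dots> = sinv A s \<otimes> (p \<otimes> (s \<otimes> f))"
      using p s f by simp
    finally have "f \<otimes> (sinv A s \<otimes> s) = f"
      using qf f s by simp
    then have f_eq: "f = sinv A s \<otimes> (s \<otimes> (f \<otimes> sinv A s)) \<otimes> s"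
      using f s by simp
    have "s \<otimes> (f \<otimes> sinv A s) = s \<otimes> (sinv A s \<otimes> (p \<otimes> (s \<otimes> f))) \<otimes> sinv A s"
      unfolding qf using f s by simp
    also have "\<dots> = p \<otimes> (s \<otimes> (f \<otimes> sinv A s))"
      using p s f by simp
    finally have "p \<otimes> (s \<otimes> (f \<otimes> sinv A s)) = s \<otimes> (f \<otimes> sinv A s)" ..
    moreover have "s \<otimes> (f \<otimes> sinv A s) \<noteq> Z"
    proof
      assume zero: "s \<otimes> (f \<otimes> sinv A s) = Z"
      have "f = Z"
        using f_eq s unfolding zero by simp
      then show False
        using f by simp
    qed
    ultimately have sfs: "s \<otimes> (f \<otimes> sinv A s) = p"
      using atom_le_idem[OF p, of "s \<otimes> (f \<otimes> sinv A s)"] s f by simp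
    show ?thesis
      using f_eq p s unfolding sfs by simp
  qed
  then show ?thesis
    using conj_nonzero[OF p s] p s ps by (intro atomI) simp_all
qed

end

section \<open>Local algebras\<close>

context inverse_semigroup
begin

lemma mult_local_algebra [simp]: "(\<otimes>\<^bsub>local_algebra A e\<^esub>) = (\<otimes>)"
  and one_local_algebra [simp]: "\<one>\<^bsub>local_algebra A e\<^esub> = e"
  by (simp_all add: local_algebra_def)

lemma carrier_local_algebra:
  assumes "e \<in> E"
  shows "carrier (local_algebra A e) = {x \<in> carrier A. e \<otimes> x = x \<and> x \<otimes> e = x}"
proof -
  have "\<exists>y. x = e \<otimes> y \<otimes> e \<and> y \<in> carrier A" if "x \<in> carrier A" "e \<otimes> x = x" "x \<otimes> e = x" for x
    using that by (intro exI[of _ x]) simp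
  then show ?thesis
    using assms by (auto simp: local_algebra_def)
qed

lemma sinv_mem_local_algebra:
  assumes e: "e \<in> E" and x: "x \<in> carrier (local_algebra A e)"
  shows "sinv A x \<in> carrier (local_algebra A e)"
proof -
  from assms have x': "x \<in> carrier A" "e \<otimes> x = x" "x \<otimes> e = x"
    by (auto simp: carrier_local_algebra)
  then have "sinv A x \<otimes> e = sinv A x" "e \<otimes> sinv A x = sinv A x"
    using e sinv_mult[of e x] sinv_mult[of x e] by simp_all
  then show ?thesis
    using e x' by (simp add: carrier_local_algebra)
qed

text \<open>
  Inverses taken in \<open>A\<close> stay in the local algebra, and their uniqueness is inherited from \<open>A\<close>.
\<close>

lemma inverse_semigroup_local_algebra:
  assumes e: "e \<in> E"
  shows "inverse_semigroup (local_algebra A e)"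
proof
  fix x
  assume x: "x \<in> carrier (local_algebra A e)"
  show "\<exists>!y. y \<in> carrier (local_algebra A e) \<and> x \<otimes>\<^bsub>local_algebra A e\<^esub> y \<otimes>\<^bsub>local_algebra A e\<^esub> x = x
    \<and> y \<otimes>\<^bsub>local_algebra A e\<^esub> x \<otimes>\<^bsub>local_algebra A e\<^esub> y = y"
  proof (rule ex1I[of _ "sinv A x"])
    show "sinv A x \<in> carrier (local_algebra A e) \<and>
      x \<otimes>\<^bsub>local_algebra A e\<^esub> sinv A x \<otimes>\<^bsub>local_algebra A e\<^esub> x = x \<and>
      sinv A x \<otimes>\<^bsub>local_algebra A e\<^esub> x \<otimes>\<^bsub>local_algebra A e\<^esub> sinv A x = sinv A x"
      using x e sinv_mem_local_algebra[OF e x] by (simp add: carrier_local_algebra)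
  next
    fix y
    assume "y \<in> carrier (local_algebra A e) \<and> x \<otimes>\<^bsub>local_algebra A e\<^esub> y \<otimes>\<^bsub>local_algebra A e\<^esub> x = x
      \<and> y \<otimes>\<^bsub>local_algebra A e\<^esub> x \<otimes>\<^bsub>local_algebra A e\<^esub> y = y"
    then show "y = sinv A x"
      using x e by (intro sinv_unique[symmetric]) (auto simp: carrier_local_algebra)
  qed
next
  fix x y
  assume "x \<in> carrier (local_algebra A e)" "y \<in> carrier (local_algebra A e)"
  moreover from this have "e \<otimes> (x \<otimes> y) = x \<otimes> y"
    using e mult_assoc[of e x y] by (auto simp: carrier_local_algebra simp del: mult_assoc)
  ultimately show "x \<otimes>\<^bsub>local_algebra A e\<^esub> y \<in> carrier (local_algebra A e)"
    using e by (auto simp: carrier_local_algebra)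
qed (use e in \<open>auto simp: carrier_local_algebra\<close>)

lemma sinv_local_algebra:
  assumes e: "e \<in> E" and x: "x \<in> carrier (local_algebra A e)"
  shows "sinv (local_algebra A e) x = sinv A x"
proof -
  interpret B: inverse_semigroup "local_algebra A e"
    using e by (rule inverse_semigroup_local_algebra)
  show ?thesis
    using x sinv_mem_local_algebra[OF e x] e
    by (intro B.sinv_unique) (auto simp: carrier_local_algebra)
qed

lemma idempotents_local_algebra:
  assumes e: "e \<in> E"
  shows "idempotents (local_algebra A e) = {f \<in> E. f \<otimes> e = f}"
  using idem_commute[OF e] unfolding idempotents_def[of "local_algebra A e"]
  by (auto simp: carrier_local_algebra[OF e] intro: idemI)

end

context inverse_semigroup_zero
begin

lemma zero_local_algebra:
  assumes e: "e \<in> E"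
  shows "zero_elem (local_algebra A e) = Z"
    and inverse_semigroup_zero_local_algebra: "inverse_semigroup_zero (local_algebra A e)"
proof -
  interpret B: inverse_semigroup "local_algebra A e"
    using e by (rule inverse_semigroup_local_algebra)
  have 1: "Z \<in> carrier (local_algebra A e)"
    using e by (simp add: carrier_local_algebra)
  have 2: "B.nat_le Z x" if "x \<in> carrier (local_algebra A e)" for x
    using that B.nat_leI[of Z x] e by (simp add: carrier_local_algebra idempotents_local_algebra)
  show "zero_elem (local_algebra A e) = Z"
    using 1 2 by (rule B.zero_elem_eqI)
  show "inverse_semigroup_zero (local_algebra A e)"
    using 1 2 by (rule B.inverse_semigroup_zeroI)
qed

lemma idem_atoms_local_algebra:
  assumes e: "e \<in> E"
  shows "idem_atoms (local_algebra A e) = {p \<in> P. p \<otimes> e = p}"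
proof -
  interpret B: inverse_semigroup_zero "local_algebra A e"
    using e by (rule inverse_semigroup_zero_local_algebra)
  have "f \<otimes> e = f" if "f \<in> E" "p \<in> E" "f \<otimes> p = f" "p \<otimes> e = p" for f p
    using that e by (metis idem_closed mult_assoc)
  then show ?thesis
    unfolding B.idem_atoms_eq idem_atoms_eq mult_local_algebra
      zero_local_algebra[OF e] idempotents_local_algebra[OF e]
    by blast
qed

end

section \<open>Dispersed subsemigroups\<close>

locale dispersed_subsemigroup = monoid A + inverse_meet_semigroup A for A (structure) +
  fixes S :: "'a set"
  assumes complete: "nat_complete A" and atomistic: "nat_atomistic A"
    and subsemigroup: "inverse_subsemigroup S A" and disp: "dispersed A S"
begin

sublocale inverse_semigroup_zero A
proof -
  obtain z where "is_glb (nat_order A) z (carrier A)"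
    using complete one_closed unfolding nat_complete_def by (metis empty_iff order_refl)
  then show "inverse_semigroup_zero A"
    by (intro inverse_semigroup_zeroI[of z]) (auto simp: greatest_def Lower_def)
qed

lemma one_idem [simp]: "\<one> \<in> E"
  by (intro idemI) simp_all

lemma S_closed [simp]: "s \<in> S \<Longrightarrow> s \<in> carrier A"
  and S_sinv [simp]: "s \<in> S \<Longrightarrow> sinv A s \<in> S"
  and S_mult [simp]: "\<lbrakk>s \<in> S; t \<in> S\<rbrakk> \<Longrightarrow> s \<otimes> t \<in> S"
  using subsemigroup by (auto simp: inverse_subsemigroup_def)

text \<open>
  A set of idempotents is bounded above by \<open>\<one>\<close>; its supremum is the infimum of its upper bounds.
\<close>

lemma sup_is_lub:
  assumes "X \<subseteq> E"
  shows "is_lub (nat_order A) (\<Squnion>\<^bsub>nat_order A\<^esub> X) X"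
proof -
  have "\<one> \<in> Upper (nat_order A) X"
    using assms by (auto simp: Upper_def idem_le_iff)
  moreover have "Upper (nat_order A) X \<subseteq> carrier A"
    by (auto simp: Upper_def)
  ultimately obtain m where "is_glb (nat_order A) m (Upper (nat_order A) X)"
    using complete unfolding nat_complete_def by blast
  then have m: "m \<in> carrier A" "\<And>u. u \<in> Upper (nat_order A) X \<Longrightarrow> m \<preceq> u"
    "\<And>l. l \<in> Lower (nat_order A) (Upper (nat_order A) X) \<Longrightarrow> l \<preceq> m"
    unfolding greatest_def by (auto simp: Lower_def Upper_def)
  have "is_lub (nat_order A) m X"
  proof (rule least_UpperI)
    fix x assume "x \<in> X"
    then show "x \<preceq> m"
      using assms by (intro m(3)) (auto simp: Lower_def Upper_def)
  qed (use m assms in auto)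
  then show ?thesis
    using sup_eq by metis
qed

lemma sup_idem: "X \<subseteq> E \<Longrightarrow> \<Squnion>\<^bsub>nat_order A\<^esub> X \<in> E"
proof -
  assume X: "X \<subseteq> E"
  then have "\<one> \<in> Upper (nat_order A) X"
    by (auto simp: Upper_def idem_le_iff)
  then have "\<Squnion>\<^bsub>nat_order A\<^esub> X \<preceq> \<one>"
    using sup_is_lub[OF X] by (simp add: least_def)
  then show ?thesis
    by (rule le_idem_imp_idem) simp
qed

text \<open>
  An idempotent is a supremum of atoms of \<open>A\<close>; these lie below an idempotent, so they are idempotent
  themselves and hence atoms of \<open>E\<close>.
\<close>

lemma idem_le_by_atoms:
  assumes g: "g \<in> E" and h: "h \<in> E" and le: "\<And>p. \<lbrakk>p \<in> P; p \<otimes> g = p\<rbrakk> \<Longrightarrow> p \<otimes> h = p"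
  shows "g \<otimes> h = g"
proof -
  obtain Y where Y: "Y \<subseteq> order_atoms (nat_order A)" "is_lub (nat_order A) g Y"
    using atomistic g unfolding nat_atomistic_def by (meson idem_closed)
  have "y \<preceq> h" if y: "y \<in> Y" for y
  proof -
    have yc: "y \<in> carrier A"
      using y Y by (auto simp: order_atoms_def)
    then have yg: "y \<preceq> g"
      using y Y(2) by (auto simp: least_def Upper_def)
    then have yE: "y \<in> E"
      using g by (rule le_idem_imp_idem)
    have "y \<noteq> Z" "\<And>f. \<lbrakk>f \<in> carrier A; f \<noteq> Z; f \<preceq> y\<rbrakk> \<Longrightarrow> f = y"
      using y Y(1) by (auto simp: order_atoms_def bottom_nat_order)
    then have "y \<in> P"
      using yE by (intro atomI) (simp_all add: idem_le_iff)
    then show ?thesis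
      using le yg yE g h by (simp add: idem_le_iff)
  qed
  then have "h \<in> Upper (nat_order A) Y"
    using h by (auto simp: Upper_def)
  then have "g \<preceq> h"
    using Y(2) by (simp add: least_def)
  then show ?thesis
    using g h by (simp add: idem_le_iff)
qed

text \<open>
  The domain of the partial equivalence \<open>\<T>\<^sub>S\<close>.
\<close>

definition supp :: "'a set" where
  "supp = {p \<in> P. \<exists>s\<in>S. p \<otimes> s \<noteq> Z}"

text \<open>
  The conjugate of an atom is an atom as soon as it is non-zero, so the second membership in the
  definition of \<^const>\<open>trans_rel\<close> can be traded for \<open>p \<otimes> s \<noteq> Z\<close>.
\<close>

lemma trans_rel_iff:
  "(p, q) \<in> trans_rel A S \<longleftrightarrow> p \<in> P \<and> (\<exists>s\<in>S. p \<otimes> s \<noteq> Z \<and> q = sinv A s \<otimes> (p \<otimes> s))"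
proof
  assume "(p, q) \<in> trans_rel A S"
  then obtain s where s: "p \<in> P" "q \<in> P" "s \<in> S" "q = sinv A s \<otimes> p \<otimes> s"
    unfolding trans_rel_def by blast
  then have "sinv A s \<otimes> (p \<otimes> s) \<noteq> Z"
    using atom_nonzero[of q] by simp
  then have "p \<otimes> s \<noteq> Z"
    using conj_nonzero[of p s] s by simp
  with s show "p \<in> P \<and> (\<exists>s\<in>S. p \<otimes> s \<noteq> Z \<and> q = sinv A s \<otimes> (p \<otimes> s))"
    by auto
next
  assume "p \<in> P \<and> (\<exists>s\<in>S. p \<otimes> s \<noteq> Z \<and> q = sinv A s \<otimes> (p \<otimes> s))"
  then obtain s where s: "p \<in> P" "s \<in> S" "p \<otimes> s \<noteq> Z" "q = sinv A s \<otimes> (p \<otimes> s)"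
    by blast
  then have "q \<in> P" "q = sinv A s \<otimes> p \<otimes> s"
    using conj_atom[of p s] by simp_all
  with s show "(p, q) \<in> trans_rel A S"
    unfolding trans_rel_def by blast
qed

lemma equiv_trans_rel: "equiv supp (trans_rel A S)"
proof (rule equivI)
  show "trans_rel A S \<subseteq> supp \<times> supp"
  proof clarify
    fix p q
    assume "(p, q) \<in> trans_rel A S"
    then obtain s where s: "p \<in> P" "s \<in> S" "p \<otimes> s \<noteq> Z" "q = sinv A s \<otimes> (p \<otimes> s)"
      by (auto simp: trans_rel_iff)
    have qs: "q \<otimes> sinv A s \<noteq> Z"
    proof
      assume zero: "q \<otimes> sinv A s = Z"
      have "p = s \<otimes> (q \<otimes> sinv A s)"
        unfolding s(4) using conj_conj[of p s] s(1-3) by simp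
      also have "\<dots> = Z"
        unfolding zero using s(2) by simp
      finally show False
        using s(1) atom_nonzero by blast
    qed
    have "q \<in> P" "sinv A s \<in> S"
      using conj_atom[of p s] s by simp_all
    then have "q \<in> supp"
      unfolding supp_def using qs by blast
    moreover have "p \<in> supp"
      unfolding supp_def using s(1-3) by blast
    ultimately show "p \<in> supp \<and> q \<in> supp"
      by blast
  qed
  show "refl_on supp (trans_rel A S)"
  proof (rule refl_onI)
    fix p
    assume "p \<in> supp"
    then obtain s where s: "p \<in> P" "s \<in> S" "p \<otimes> s \<noteq> Z"
      by (auto simp: supp_def)
    \<comment> \<open>\<open>S\<close> contains the idempotent \<open>r\<close>, and conjugation by it fixes \<open>p\<close>.\<close>
    define r where "r = s \<otimes> sinv A s"
    have r: "r \<in> S" "r \<in> E" "p \<otimes> r = p"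
      using s atom_below_range[of p s] by (simp_all add: r_def)
    then have "r \<otimes> p = p"
      using s idem_commute[of r p] by simp
    with r s show "(p, p) \<in> trans_rel A S"
      unfolding trans_rel_iff using atom_nonzero[of p] by (intro conjI bexI[of _ r]) simp_all
  qed
  show "sym (trans_rel A S)"
  proof (rule symI)
    fix p q
    assume "(p, q) \<in> trans_rel A S"
    then obtain s where s: "p \<in> P" "s \<in> S" "p \<otimes> s \<noteq> Z" "q = sinv A s \<otimes> (p \<otimes> s)"
      by (auto simp: trans_rel_iff)
    then have "q \<in> P" "p = sinv A (sinv A s) \<otimes> q \<otimes> sinv A s"
      using conj_atom[of p s] conj_conj[of p s] by simp_all
    moreover have "sinv A s \<in> S"
      using s by simp
    ultimately show "(q, p) \<in> trans_rel A S"
      using s(1) unfolding trans_rel_def by blast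
  qed
  show "trans (trans_rel A S)"
  proof (rule transI)
    fix p q r
    assume "(p, q) \<in> trans_rel A S" "(q, r) \<in> trans_rel A S"
    then obtain s t where s: "p \<in> P" "s \<in> S" "q = sinv A s \<otimes> p \<otimes> s"
      and t: "r \<in> P" "t \<in> S" "r = sinv A t \<otimes> q \<otimes> t"
      by (auto simp: trans_rel_def)
    then have "r = sinv A (s \<otimes> t) \<otimes> p \<otimes> (s \<otimes> t)" "s \<otimes> t \<in> S"
      by (simp_all add: sinv_mult)
    then show "(p, r) \<in> trans_rel A S"
      using s(1) t(1) unfolding trans_rel_def by blast
  qed
qed

abbreviation tclasses :: "'a set set" where
  "tclasses \<equiv> trans_classes A S"

lemma classes_eq: "tclasses = supp // trans_rel A S"
  by (simp add: trans_classes_def supp_def)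

abbreviation class_sup :: "'a set \<Rightarrow> 'a" where
  "class_sup C \<equiv> \<Squnion>\<^bsub>nat_order A\<^esub> C"

lemma class_subset: "C \<in> tclasses \<Longrightarrow> C \<subseteq> supp"
  unfolding classes_eq using equiv_trans_rel by (rule in_quotient_imp_subset)

lemma supp_atom: "p \<in> supp \<Longrightarrow> p \<in> P"
  by (simp add: supp_def)

lemma class_idem: "C \<in> tclasses \<Longrightarrow> C \<subseteq> E"
  using class_subset supp_atom by force

lemma class_sup_idem [simp]: "C \<in> tclasses \<Longrightarrow> class_sup C \<in> E"
  using sup_idem class_idem by blast

text \<open>
  The direction from right to left is the use of dispersedness: an atom of \<open>supp\<close> below the supremum
  of \<open>C\<close> lies in the local algebra of \<open>C\<close>, so its own class cannot differ from \<open>C\<close>.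
\<close>

lemma mem_class_iff:
  assumes C: "C \<in> tclasses" and p: "p \<in> supp"
  shows "p \<in> C \<longleftrightarrow> p \<otimes> class_sup C = p"
proof
  assume "p \<in> C"
  then have "p \<preceq> class_sup C"
    using sup_is_lub[OF class_idem[OF C]] class_idem[OF C] by (auto simp: least_def Upper_def)
  then show "p \<otimes> class_sup C = p"
    using C p supp_atom by (simp add: idem_le_iff)
next
  assume le: "p \<otimes> class_sup C = p"
  define D where "D = trans_rel A S `` {p}"
  have D: "D \<in> tclasses" "p \<in> D"
    using p equiv_class_self[OF equiv_trans_rel p] by (auto simp: D_def classes_eq quotientI)
  have "p \<in> carrier (local_algebra A (class_sup C))"
    using le C p supp_atom[of p] idem_commute[of p "class_sup C"] by (simp add: carrier_local_algebra)
  then have "C = D"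
    using disp C D unfolding dispersed_def by blast
  then show "p \<in> C"
    using D by simp
qed

lemma class_sup_least:
  assumes C: "C \<in> tclasses" and f: "f \<in> E" and le: "\<And>p. p \<in> C \<Longrightarrow> p \<otimes> f = p"
  shows "class_sup C \<otimes> f = class_sup C"
proof -
  have "f \<in> Upper (nat_order A) C"
    using f le class_idem[OF C] by (auto simp: Upper_def idem_le_iff)
  then have "class_sup C \<preceq> f"
    using sup_is_lub[OF class_idem[OF C]] by (simp add: least_def)
  then show ?thesis
    using f C by (simp add: idem_le_iff)
qed

lemma class_conj_closed:
  assumes C: "C \<in> tclasses" and p: "p \<in> C" and s: "s \<in> S" and ps: "p \<otimes> s \<noteq> Z"
  shows "sinv A s \<otimes> (p \<otimes> s) \<in> C"
proof -
  have "(p, sinv A s \<otimes> (p \<otimes> s)) \<in> trans_rel A S"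
    using assms class_subset supp_atom trans_rel_iff by blast
  then show ?thesis
    using C p equiv_trans_rel unfolding classes_eq by (metis in_quotient_imp_closed)
qed

lemma below_range_imp_supp:
  assumes "p \<in> P" "s \<in> S" "p \<otimes> (s \<otimes> sinv A s) = p"
  shows "p \<otimes> s \<noteq> Z" "p \<in> supp"
proof -
  show "p \<otimes> s \<noteq> Z"
  proof
    assume "p \<otimes> s = Z"
    then have "p \<otimes> s \<otimes> sinv A s = Z"
      using assms by simp
    then show False
      using assms atom_nonzero by simp
  qed
  then show "p \<in> supp"
    using assms by (auto simp: supp_def)
qed

text \<open>
  With \<open>g\<close> and \<open>h\<close> as in the proof, \<open>g \<otimes> h = g\<close> is checked on atoms: an atom \<open>p\<close> below \<open>g\<close> lies in
  \<open>C\<close>, hence so does its conjugate by \<open>s\<close>, and conjugating back places \<open>p\<close> below \<open>h\<close>.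
\<close>

lemma class_sup_mult_sandwich:
  assumes C: "C \<in> tclasses" and s: "s \<in> S"
  shows "class_sup C \<otimes> s = class_sup C \<otimes> (s \<otimes> class_sup C)"
proof -
  let ?g = "class_sup C \<otimes> (s \<otimes> sinv A s)" and ?h = "s \<otimes> (class_sup C \<otimes> sinv A s)"
  have "?g \<otimes> ?h = ?g"
  proof (rule idem_le_by_atoms)
    fix p
    assume p: "p \<in> P" and pg: "p \<otimes> ?g = p"
    have pe: "p \<otimes> class_sup C = p" and pr: "p \<otimes> (s \<otimes> sinv A s) = p"
    proof -
      have "p \<otimes> class_sup C = p \<otimes> ?g \<otimes> class_sup C"
        using pg by simp
      also have "\<dots> = p \<otimes> ?g"
        using p C s by simp
      finally show "p \<otimes> class_sup C = p"
        using pg by simp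
      have "p \<otimes> (s \<otimes> sinv A s) = p \<otimes> ?g \<otimes> (s \<otimes> sinv A s)"
        using pg by simp
      also have "\<dots> = p \<otimes> ?g"
        using p C s by simp
      finally show "p \<otimes> (s \<otimes> sinv A s) = p"
        using pg by simp
    qed
    let ?q = "sinv A s \<otimes> (p \<otimes> s)"
    have ps: "p \<otimes> s \<noteq> Z" and "p \<in> supp"
      using below_range_imp_supp p s pr by blast+
    then have "p \<in> C"
      using C pe by (simp add: mem_class_iff)
    then have "?q \<in> C"
      using C s ps by (simp add: class_conj_closed)
    then have qe: "?q \<otimes> class_sup C = ?q"
      using C class_subset mem_class_iff by blast
    have "p \<otimes> ?h = s \<otimes> ((?q \<otimes> class_sup C) \<otimes> sinv A s)"
      using p s C by simp
    also have "\<dots> = p"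
      unfolding qe using pr p s by simp
    finally show "p \<otimes> ?h = p" .
  qed (use C s in simp_all)
  then have "?g \<otimes> ?h \<otimes> s = ?g \<otimes> s"
    by (rule arg_cong)
  moreover have "?g \<otimes> s = class_sup C \<otimes> s"
    using C s by simp
  moreover have "?g \<otimes> ?h \<otimes> s = class_sup C \<otimes> (s \<otimes> class_sup C)"
    using C s by simp
  ultimately show ?thesis
    by simp
qed

text \<open>
  Inverting the preceding identity for \<open>sinv A s\<close> gives its mirror image for \<open>s\<close>.
\<close>

lemma class_sup_central:
  assumes C: "C \<in> tclasses" and s: "s \<in> S"
  shows "class_sup C \<otimes> s = s \<otimes> class_sup C"
proof -
  have "sinv A (class_sup C \<otimes> sinv A s) = sinv A (class_sup C \<otimes> (sinv A s \<otimes> class_sup C))"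
    using class_sup_mult_sandwich[OF C, of "sinv A s"] s by simp
  then have "s \<otimes> class_sup C = class_sup C \<otimes> (s \<otimes> class_sup C)"
    using C s by (simp add: sinv_mult)
  then show ?thesis
    using class_sup_mult_sandwich[OF C s] by simp
qed

lemma class_sup_mult_mem: "\<lbrakk>C \<in> tclasses; s \<in> S\<rbrakk> \<Longrightarrow> class_sup C \<otimes> s \<in> carrier (local_algebra A (class_sup C))"
  by (simp add: carrier_local_algebra flip: class_sup_mult_sandwich)

lemma class_sup_mult_mult:
  assumes "C \<in> tclasses" "s \<in> S" "t \<in> S"
  shows "class_sup C \<otimes> s \<otimes> (class_sup C \<otimes> t) = class_sup C \<otimes> (s \<otimes> t)"
proof -
  have "class_sup C \<otimes> s \<otimes> (class_sup C \<otimes> t) = (class_sup C \<otimes> (s \<otimes> class_sup C)) \<otimes> t"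
    using assms by simp
  then show ?thesis
    using assms by (simp flip: class_sup_mult_sandwich)
qed

lemma sinv_class_sup_mult:
  "\<lbrakk>C \<in> tclasses; s \<in> S\<rbrakk> \<Longrightarrow> sinv A (class_sup C \<otimes> s) = class_sup C \<otimes> sinv A s"
  by (simp add: sinv_mult class_sup_central)

text \<open>
  An upper bound \<open>u\<close> of the components need not be comparable with \<open>s\<close>, but the meet \<open>m\<close> of \<open>s\<close> and
  \<open>u\<close> is an upper bound below \<open>s\<close>, and is thus determined by its range idempotent. Every atom below
  \<open>s \<otimes> sinv A s\<close> lies in some class \<open>C\<close> and is therefore detected by the component at \<open>C\<close>, so the
  range idempotents of \<open>m\<close> and \<open>s\<close> agree.
\<close>

lemma lub_components:
  assumes s: "s \<in> S"
  shows "is_lub (nat_order A) s ((\<lambda>C. class_sup C \<otimes> s) ` tclasses)"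
proof (rule least_UpperI)
  fix x
  assume "x \<in> (\<lambda>C. class_sup C \<otimes> s) ` tclasses"
  then show "x \<preceq> s"
    using s by (auto intro: nat_leI)
next
  fix u
  assume "u \<in> Upper (nat_order A) ((\<lambda>C. class_sup C \<otimes> s) ` tclasses)"
  then have u: "u \<in> carrier A" "\<And>C. C \<in> tclasses \<Longrightarrow> class_sup C \<otimes> s \<preceq> u"
    using s by (auto simp: Upper_def)
  obtain m where "is_glb (nat_order A) m {s, u}"
    using meet_exists[of s u] s u by auto
  then have m: "m \<in> carrier A" "m \<preceq> s" "m \<preceq> u"
      "\<And>l. \<lbrakk>l \<in> carrier A; l \<preceq> s; l \<preceq> u\<rbrakk> \<Longrightarrow> l \<preceq> m"
    using s u unfolding greatest_def by (auto simp: Lower_def)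
  have "s \<otimes> sinv A s \<otimes> (m \<otimes> sinv A m) = s \<otimes> sinv A s"
  proof (rule idem_le_by_atoms)
    fix p
    assume p: "p \<in> P" and pr: "p \<otimes> (s \<otimes> sinv A s) = p"
    have ps: "p \<otimes> s \<noteq> Z" and "p \<in> supp"
      using below_range_imp_supp p s pr by blast+
    then obtain C where C: "C \<in> tclasses" "p \<in> C"
      using equiv_trans_rel by (metis Union_iff Union_quotient classes_eq)
    then have pe: "p \<otimes> class_sup C = p"
      using \<open>p \<in> supp\<close> mem_class_iff by blast
    have "class_sup C \<otimes> s \<preceq> m"
      using m(4) u(2) C s by (simp add: nat_leI)
    then obtain f where f: "f \<in> E" "class_sup C \<otimes> s = f \<otimes> m"
      by (auto simp: nat_order_def)
    have "p \<otimes> s = (p \<otimes> f) \<otimes> m"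
    proof -
      have "p \<otimes> s = p \<otimes> class_sup C \<otimes> s"
        using pe by simp
      then show ?thesis
        using C s f p m by simp
    qed
    then have "p \<otimes> m \<noteq> Z"
      using ps p f m idem_left_commute[of p f m] by auto
    then show "p \<otimes> (m \<otimes> sinv A m) = p"
      using atom_below_range p m by blast
  qed (use s m in simp_all)
  then have "s = s \<otimes> sinv A s \<otimes> (m \<otimes> sinv A m) \<otimes> s"
    using s by simp
  also have "\<dots> = s \<otimes> (sinv A s \<otimes> (m \<otimes> sinv A m \<otimes> s))"
    using s m by (simp del: range_commute)
  also have "m \<otimes> sinv A m \<otimes> s = m"
    using m s by (simp add: nat_le_iff[of s m])
  finally have "s = s \<otimes> (sinv A s \<otimes> m)" .
  then have "s \<preceq> m"
    using m s by (simp add: nat_le_iff)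
  then show "s \<preceq> u"
    using m u s nat.le_trans[of s m u] by simp
qed (use s in auto)

text \<open>
  An idempotent \<open>f\<close> whose local algebra contains the factor fixes every \<open>e\<^sub>C \<otimes> s\<close>. Each atom \<open>p\<close> of
  \<open>C\<close> has some \<open>p \<otimes> s \<noteq> Z\<close>, so it does not annihilate \<open>f\<close> and thus lies below it; hence \<open>e\<^sub>C\<close>
  does too.
\<close>

lemma weakly_effective_component:
  assumes C: "C \<in> tclasses"
  shows "weakly_effective (local_algebra A (class_sup C)) ((\<lambda>s. class_sup C \<otimes> s) ` S)"
  unfolding weakly_effective_def
proof (intro ballI impI)
  fix f
  assume f: "f \<in> idempotents (local_algebra A (class_sup C))"
    and sub: "(\<lambda>s. class_sup C \<otimes> s) ` S \<subseteq> carrier (local_algebra (local_algebra A (class_sup C)) f)"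
  interpret B: inverse_semigroup "local_algebra A (class_sup C)"
    using C by (simp add: inverse_semigroup_local_algebra)
  have f': "f \<in> E" "f \<otimes> class_sup C = f"
    using f C by (simp_all add: idempotents_local_algebra)
  have "class_sup C \<otimes> f = class_sup C"
  proof (rule class_sup_least[OF C f'(1)])
    fix p
    assume p: "p \<in> C"
    then have "p \<in> supp"
      using class_subset[OF C] by blast
    then obtain s where s: "p \<in> P" "s \<in> S" "p \<otimes> s \<noteq> Z"
      unfolding supp_def by blast
    have pe: "p \<otimes> class_sup C = p"
      using p C \<open>p \<in> supp\<close> mem_class_iff by blast
    have "class_sup C \<otimes> s \<in> carrier (local_algebra (local_algebra A (class_sup C)) f)"
      using sub s by blast
    then have fs: "f \<otimes> (class_sup C \<otimes> s) = class_sup C \<otimes> s"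
      using f by (simp add: B.carrier_local_algebra)
    have "p \<otimes> s = p \<otimes> class_sup C \<otimes> s"
      using pe by simp
    also have "\<dots> = p \<otimes> (f \<otimes> (class_sup C \<otimes> s))"
      using fs s C by simp
    also have "\<dots> = p \<otimes> f \<otimes> (class_sup C \<otimes> s)"
      using s f' C by simp
    finally have "p \<otimes> f \<noteq> Z"
      using s C by auto
    then show "p \<otimes> f = p"
      by (rule atom_le_idem[OF s(1) f'(1)])
  qed
  then show "f = \<one>\<^bsub>local_algebra A (class_sup C)\<^esub>"
    using f' C idem_commute[of f "class_sup C"] by simp
qed

lemma mult_component:
  assumes "C \<in> tclasses" "p \<in> E" "p \<otimes> class_sup C = p" "s \<in> S"
  shows "p \<otimes> (class_sup C \<otimes> s) = p \<otimes> s"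
proof -
  have "p \<otimes> (class_sup C \<otimes> s) = p \<otimes> class_sup C \<otimes> s"
    using assms(1,2,4) by simp
  then show ?thesis
    using assms(3) by simp
qed

lemma trans_rel_component:
  assumes C: "C \<in> tclasses"
  shows "trans_rel (local_algebra A (class_sup C)) ((\<lambda>s. class_sup C \<otimes> s) ` S)
    = {(p, q) \<in> trans_rel A S. p \<otimes> class_sup C = p \<and> q \<otimes> class_sup C = q}"
proof -
  have "sinv (local_algebra A (class_sup C)) (class_sup C \<otimes> s) \<otimes> p \<otimes> (class_sup C \<otimes> s) = sinv A s \<otimes> p \<otimes> s"
    if s: "s \<in> S" and p: "p \<in> E" "p \<otimes> class_sup C = p" for s p
  proof -
    have ep: "class_sup C \<otimes> p = p"
      using p C idem_commute[of p "class_sup C"] by simp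
    have "sinv (local_algebra A (class_sup C)) (class_sup C \<otimes> s) = sinv A s \<otimes> class_sup C"
      using C s class_sup_mult_mem[OF C s] by (simp add: sinv_local_algebra sinv_mult)
    then have "sinv (local_algebra A (class_sup C)) (class_sup C \<otimes> s) \<otimes> p \<otimes> (class_sup C \<otimes> s)
      = sinv A s \<otimes> (class_sup C \<otimes> p \<otimes> (class_sup C \<otimes> s))"
      using s p C by simp
    then show ?thesis
      unfolding ep using mult_component[OF C p s] s p by simp
  qed
  then show ?thesis
    using C unfolding trans_rel_def by (auto simp: idem_atoms_local_algebra)
qed

text \<open>
  By \<open>mem_class_iff\<close> the domain of the relation of the factor is \<open>C\<close>, on which it agrees with the
  relation of \<open>S\<close>.
\<close>

lemma trans_classes_component:
  assumes C: "C \<in> tclasses"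
  shows "trans_classes (local_algebra A (class_sup C)) ((\<lambda>s. class_sup C \<otimes> s) ` S) = {C}"
proof -
  have "{p \<in> idem_atoms (local_algebra A (class_sup C)).
          \<exists>s\<in>(\<lambda>s. class_sup C \<otimes> s) ` S. p \<otimes> s \<noteq> zero_elem (local_algebra A (class_sup C))}
        = {p \<in> supp. p \<otimes> class_sup C = p}"
    using C by (auto simp: idem_atoms_local_algebra zero_local_algebra supp_def mult_component)
  also have "\<dots> = C"
    using mem_class_iff[OF C] class_subset[OF C] by blast
  finally have dom: "{p \<in> idem_atoms (local_algebra A (class_sup C)).
          \<exists>s\<in>(\<lambda>s. class_sup C \<otimes> s) ` S. p \<otimes> s \<noteq> zero_elem (local_algebra A (class_sup C))} = C" .
  have cls: "trans_rel (local_algebra A (class_sup C)) ((\<lambda>s. class_sup C \<otimes> s) ` S) `` {p} = C" if p: "p \<in> C" for p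
  proof -
    have "trans_rel A S `` {p} = C"
      using C p equiv_trans_rel unfolding classes_eq
      by (metis Image_singleton_iff equiv_class_eq_iff quotientE)
    moreover have "q \<otimes> class_sup C = q" if "q \<in> C" for q
      using that C class_subset mem_class_iff by blast
    ultimately show ?thesis
      using p unfolding trans_rel_component[OF C] by blast
  qed
  have "C \<noteq> {}"
    using C equiv_trans_rel unfolding classes_eq by (metis in_quotient_imp_non_empty)
  then show ?thesis
    unfolding trans_classes_def mult_local_algebra dom quotient_def using cls by auto
qed

text \<open>
  Effectiveness puts every atom below \<open>e\<^sub>C\<close> into \<open>supp\<close>, hence into \<open>C\<close>. For atoms related by
  \<open>q = sinv A s \<otimes> (p \<otimes> s)\<close> the product \<open>p \<otimes> s \<otimes> q\<close> is just \<open>p \<otimes> s\<close>.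
\<close>

lemma strongly_transitive_component:
  assumes C: "C \<in> tclasses" and eff: "strongly_effective A S"
  shows "strongly_transitive (local_algebra A (class_sup C)) ((\<lambda>s. class_sup C \<otimes> s) ` S)"
  unfolding strongly_transitive_def
proof (intro ballI)
  fix p q
  assume "p \<in> idem_atoms (local_algebra A (class_sup C))" "q \<in> idem_atoms (local_algebra A (class_sup C))"
  then have p: "p \<in> P" "p \<otimes> class_sup C = p" and q: "q \<in> P" "q \<otimes> class_sup C = q"
    using C by (simp_all add: idem_atoms_local_algebra)
  have "p \<in> supp" "q \<in> supp"
    using eff p q by (auto simp: strongly_effective_def supp_def)
  then have "p \<in> C" "q \<in> C"
    using C p q by (simp_all add: mem_class_iff)
  then have "(p, q) \<in> trans_rel A S"
    using C equiv_trans_rel unfolding classes_eq by (metis in_quotient_imp_in_rel empty_subsetI insert_subset)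
  then obtain s where s: "s \<in> S" "p \<otimes> s \<noteq> Z" "q = sinv A s \<otimes> (p \<otimes> s)"
    by (auto simp: trans_rel_iff)
  have "p \<otimes> s \<otimes> q = p \<otimes> s"
    using s p idem_left_commute[of "s \<otimes> sinv A s" p s] by simp
  then have "p \<otimes> (class_sup C \<otimes> s) \<otimes> q \<noteq> Z"
    using mult_component[of C p s] C p s by simp
  then show "\<exists>t\<in>(\<lambda>s. class_sup C \<otimes> s) ` S. p \<otimes>\<^bsub>local_algebra A (class_sup C)\<^esub> t \<otimes>\<^bsub>local_algebra A (class_sup C)\<^esub> q
      \<noteq> zero_elem (local_algebra A (class_sup C))"
    using s C by (auto simp: zero_local_algebra)
qed

end

section \<open>The Schein sum\<close>

lemma hom_sinv:
  assumes T: "inverse_semigroup T" and A: "inverse_semigroup A"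
    and h: "h \<in> hom T A" and t: "t \<in> carrier T"
  shows "h (sinv T t) = sinv A (h t)"
proof -
  interpret T: inverse_semigroup T by fact
  interpret A: inverse_semigroup A by fact
  have mult: "h (x \<otimes>\<^bsub>T\<^esub> y) = h x \<otimes>\<^bsub>A\<^esub> h y" if "x \<in> carrier T" "y \<in> carrier T" for x y
    using h that by (rule hom_mult)
  have closed: "h x \<in> carrier A" if "x \<in> carrier T" for x
    using h that by (rule hom_in_carrier)
  show ?thesis
    by (rule A.sinv_unique[symmetric]) (use t in \<open>simp_all add: closed flip: mult\<close>)
qed

lemma inverse_subsemigroup_image:
  assumes T: "inverse_semigroup T" and A: "inverse_semigroup A" and h: "h \<in> hom T A"
  shows "inverse_subsemigroup (h ` carrier T) A"
proof -
  interpret T: inverse_semigroup T by fact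
  show ?thesis
    unfolding inverse_subsemigroup_def
    using h hom_sinv[OF T A h, symmetric] hom_mult[OF h, symmetric] hom_in_carrier[OF h]
    by (auto intro!: imageI T.mult_closed)
qed

theorem theorem7p5:
  fixes A :: "('a, 'm) monoid_scheme" and T :: "('t, 'n) monoid_scheme" and \<rho> :: "'t \<Rightarrow> 'a"
  assumes "monoid A" and "inverse_meet_semigroup A" and "nat_complete A" and "nat_atomistic A"
    and "inverse_semigroup T"
    and "\<rho> \<in> hom T A" and "dispersed A (\<rho> ` carrier T)"
  shows "\<exists>(K :: 'a set set) (e :: 'a set \<Rightarrow> 'a) (\<psi> :: 'a set \<Rightarrow> 't \<Rightarrow> 'a).
    (\<forall>k\<in>K. e k \<in> idempotents A \<and>
       \<psi> k \<in> hom T (local_algebra A (e k)) \<and>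
       weakly_effective (local_algebra A (e k)) (\<psi> k ` carrier T) \<and>
       weakly_transitive (local_algebra A (e k)) (\<psi> k ` carrier T)) \<and>
    schein_sum_map T A K (\<lambda>k. carrier (local_algebra A (e k))) \<psi> \<and>
    weakly_equivalent T A \<rho>
      (product_group K (\<lambda>k. local_algebra A (e k))) (otimes_map K \<psi>) \<and>
    (strongly_effective A (\<rho> ` carrier T) \<longrightarrow>
       (\<forall>k\<in>K. strongly_transitive (local_algebra A (e k)) (\<psi> k ` carrier T)))"
proof -
  interpret T: inverse_semigroup T by fact
  have A: "inverse_semigroup A"
    using assms(2) by (rule inverse_meet_semigroup.axioms)
  define S where "S = \<rho> ` carrier T"
  interpret dispersed_subsemigroup A S
    using assms inverse_subsemigroup_image[OF assms(5) A assms(6)]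
    by (simp add: dispersed_subsemigroup_def dispersed_subsemigroup_axioms_def S_def)
  have \<rho>S [simp]: "\<rho> t \<in> S" if "t \<in> carrier T" for t
    using that by (simp add: S_def)
  have \<rho>mult [simp]: "\<rho> (t \<otimes>\<^bsub>T\<^esub> u) = \<rho> t \<otimes>\<^bsub>A\<^esub> \<rho> u" if "t \<in> carrier T" "u \<in> carrier T" for t u
    using assms(6) that by (rule hom_mult)
  define \<psi> where "\<psi> C t = class_sup C \<otimes>\<^bsub>A\<^esub> \<rho> t" for C t
  define \<Psi> where "\<Psi> = otimes_map tclasses \<psi>"
  have image: "\<psi> C ` carrier T = (\<lambda>s. class_sup C \<otimes>\<^bsub>A\<^esub> s) ` S" for C
    by (auto simp: \<psi>_def S_def)
  have \<psi>_mem [simp]: "\<psi> C t \<in> carrier (local_algebra A (class_sup C))"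
    if "C \<in> tclasses" "t \<in> carrier T" for C t
    using that by (simp add: \<psi>_def class_sup_mult_mem)
  have \<psi>_mult: "\<psi> C t \<otimes>\<^bsub>A\<^esub> \<psi> C u = \<psi> C (t \<otimes>\<^bsub>T\<^esub> u)"
    if "C \<in> tclasses" "t \<in> carrier T" "u \<in> carrier T" for C t u
    using that class_sup_mult_mult[of C "\<rho> t" "\<rho> u"] by (simp add: \<psi>_def)
  have \<psi>_hom: "\<psi> C \<in> hom T (local_algebra A (class_sup C))" if "C \<in> tclasses" for C
    using that by (auto intro!: homI simp: \<psi>_mult)
  have lub: "is_lub (nat_order A) (\<rho> t) (\<Psi> t ` tclasses)" if "t \<in> carrier T" for t
  proof -
    have "\<Psi> t ` tclasses = (\<lambda>C. class_sup C \<otimes>\<^bsub>A\<^esub> \<rho> t) ` tclasses"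
      by (auto simp: \<Psi>_def otimes_map_def \<psi>_def)
    then show ?thesis
      using lub_components[of "\<rho> t"] that by simp
  qed
  have \<omega>: "schein_omega A tclasses (\<Psi> t) = \<rho> t" if "t \<in> carrier T" for t
    using sup_eq[OF lub[OF that]] by (simp add: schein_omega_def)
  define Q where "Q = bounded_product A tclasses (\<lambda>C. carrier (local_algebra A (class_sup C)))"
  have multQ: "x \<otimes>\<^bsub>Q\<^esub> y = (\<lambda>C\<in>tclasses. x C \<otimes>\<^bsub>A\<^esub> y C)" for x y
    by (simp add: Q_def bounded_product_def product_group_def)
  have \<Psi>_mult: "(\<lambda>C\<in>tclasses. \<Psi> t C \<otimes>\<^bsub>A\<^esub> \<Psi> u C) = \<Psi> (t \<otimes>\<^bsub>T\<^esub> u)"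
    if "t \<in> carrier T" "u \<in> carrier T" for t u
    using that by (auto simp: \<Psi>_def otimes_map_def \<psi>_mult)
  have \<Psi>_multQ: "\<Psi> t \<otimes>\<^bsub>Q\<^esub> \<Psi> u = \<Psi> (t \<otimes>\<^bsub>T\<^esub> u)"
    if "t \<in> carrier T" "u \<in> carrier T" for t u
    unfolding multQ by (rule \<Psi>_mult[OF that])
  have \<Psi>_mem: "\<Psi> t \<in> carrier Q" if "t \<in> carrier T" for t
  proof -
    have "\<rho> t \<in> Upper (nat_order A) (\<Psi> t ` tclasses)"
      using lub[OF that] by (rule least_mem)
    then show ?thesis
      using that by (auto simp: Q_def bounded_product_def \<Psi>_def otimes_map_def)
  qed
  \<comment> \<open>The product consists of bounded tuples only, so it must be checked that the tuple of inverses,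
    the only candidate for an inverse, is bounded: it is the image of \<open>sinv T t\<close>.\<close>
  have \<Psi>_sinv: "sinv Q (\<Psi> t) = \<Psi> (sinv T t)" if t: "t \<in> carrier T" for t
    unfolding sinv_def[of Q]
  proof (rule the_equality)
    show "\<Psi> (sinv T t) \<in> carrier Q \<and> \<Psi> t \<otimes>\<^bsub>Q\<^esub> \<Psi> (sinv T t) \<otimes>\<^bsub>Q\<^esub> \<Psi> t = \<Psi> t
      \<and> \<Psi> (sinv T t) \<otimes>\<^bsub>Q\<^esub> \<Psi> t \<otimes>\<^bsub>Q\<^esub> \<Psi> (sinv T t) = \<Psi> (sinv T t)"
      using t by (simp add: \<Psi>_mem \<Psi>_multQ)
  next
    fix y
    assume y: "y \<in> carrier Q \<and> \<Psi> t \<otimes>\<^bsub>Q\<^esub> y \<otimes>\<^bsub>Q\<^esub> \<Psi> t = \<Psi> t \<and> y \<otimes>\<^bsub>Q\<^esub> \<Psi> t \<otimes>\<^bsub>Q\<^esub> y = y"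
    then have yE: "y \<in> (\<Pi>\<^sub>E C\<in>tclasses. carrier (local_algebra A (class_sup C)))"
      by (auto simp: Q_def bounded_product_def)
    show "y = \<Psi> (sinv T t)"
    proof (rule PiE_ext[OF yE])
      show "\<Psi> (sinv T t) \<in> (\<Pi>\<^sub>E C\<in>tclasses. carrier (local_algebra A (class_sup C)))"
        using \<Psi>_mem[of "sinv T t"] t by (auto simp: Q_def bounded_product_def)
      fix C
      assume C: "C \<in> tclasses"
      have yC: "y C \<in> carrier A"
        using PiE_mem[OF yE C] C by (simp add: carrier_local_algebra)
      have "\<psi> C t \<otimes>\<^bsub>A\<^esub> y C \<otimes>\<^bsub>A\<^esub> \<psi> C t = \<psi> C t" "y C \<otimes>\<^bsub>A\<^esub> \<psi> C t \<otimes>\<^bsub>A\<^esub> y C = y C"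
      proof -
        have "(\<Psi> t \<otimes>\<^bsub>Q\<^esub> y \<otimes>\<^bsub>Q\<^esub> \<Psi> t) C = \<Psi> t C" "(y \<otimes>\<^bsub>Q\<^esub> \<Psi> t \<otimes>\<^bsub>Q\<^esub> y) C = y C"
          using y by simp_all
        then show "\<psi> C t \<otimes>\<^bsub>A\<^esub> y C \<otimes>\<^bsub>A\<^esub> \<psi> C t = \<psi> C t" "y C \<otimes>\<^bsub>A\<^esub> \<psi> C t \<otimes>\<^bsub>A\<^esub> y C = y C"
          using C by (simp_all only: multQ \<Psi>_def otimes_map_def restrict_apply' simp_thms)
      qed
      then have "sinv A (\<psi> C t) = y C"
        using t C yC by (intro sinv_unique) (simp_all add: \<psi>_def)
      then show "y C = \<Psi> (sinv T t) C"
        using C t hom_sinv[OF assms(5) A assms(6) t]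
        by (simp add: \<Psi>_def otimes_map_def \<psi>_def sinv_class_sup_mult)
    qed
  qed
  have schein: "schein_sum_map T A tclasses (\<lambda>C. carrier (local_algebra A (class_sup C))) \<psi>"
  proof -
    have "inverse_subsemigroup (\<Psi> ` carrier T) Q"
      unfolding inverse_subsemigroup_def by (auto simp: \<Psi>_mem \<Psi>_sinv \<Psi>_multQ)
    moreover have "schein_omega A tclasses \<in> hom (Q\<lparr>carrier := \<Psi> ` carrier T\<rparr>) A"
    proof (rule homI)
      fix x y
      assume "x \<in> carrier (Q\<lparr>carrier := \<Psi> ` carrier T\<rparr>)" "y \<in> carrier (Q\<lparr>carrier := \<Psi> ` carrier T\<rparr>)"
      then show "schein_omega A tclasses (x \<otimes>\<^bsub>Q\<lparr>carrier := \<Psi> ` carrier T\<rparr>\<^esub> y)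
        = schein_omega A tclasses x \<otimes>\<^bsub>A\<^esub> schein_omega A tclasses y"
        by (auto simp: \<Psi>_multQ \<omega>)
    qed (auto simp: \<omega>)
    ultimately show ?thesis
      unfolding schein_sum_map_def schein_sum_def Q_def[symmetric] \<Psi>_def[symmetric]
      using \<Psi>_mem by blast
  qed
  have equiv: "weakly_equivalent T A \<rho> (product_group tclasses (\<lambda>C. local_algebra A (class_sup C))) \<Psi>"
    unfolding weakly_equivalent_def
  proof (intro bexI ballI)
    let ?\<theta> = "\<lambda>s. \<lambda>C\<in>tclasses. class_sup C \<otimes>\<^bsub>A\<^esub> s"
    have \<theta>: "?\<theta> (\<rho> t) = \<Psi> t" for t
      by (simp add: \<Psi>_def otimes_map_def \<psi>_def)
    then show "?\<theta> (\<rho> t) = \<Psi> t" if "t \<in> carrier T" for t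
      by simp
    \<comment> \<open>The supremum map is a left inverse of \<open>?\<theta>\<close>.\<close>
    have "inj_on ?\<theta> (\<rho> ` carrier T)"
    proof (rule inj_onI, clarify)
      fix t u
      assume "t \<in> carrier T" "u \<in> carrier T" "?\<theta> (\<rho> t) = ?\<theta> (\<rho> u)"
      then show "\<rho> t = \<rho> u"
        unfolding \<theta> using \<omega> by metis
    qed
    moreover have "?\<theta> ` \<rho> ` carrier T = \<Psi> ` carrier T"
      by (simp add: image_image \<theta>)
    ultimately show "?\<theta> \<in> iso (A\<lparr>carrier := \<rho> ` carrier T\<rparr>)
        ((product_group tclasses (\<lambda>C. local_algebra A (class_sup C)))\<lparr>carrier := \<Psi> ` carrier T\<rparr>)"
      by (auto simp: iso_def bij_betw_def hom_def \<theta> \<Psi>_mult simp flip: \<rho>mult)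
  qed
  show ?thesis
  proof (intro exI[of _ tclasses] exI[of _ class_sup] exI[of _ \<psi>] conjI ballI impI)
    fix C
    assume C: "C \<in> tclasses"
    show "class_sup C \<in> idempotents A" "\<psi> C \<in> hom T (local_algebra A (class_sup C))"
      "weakly_effective (local_algebra A (class_sup C)) (\<psi> C ` carrier T)"
      using C by (simp_all add: \<psi>_hom image weakly_effective_component)
    show "weakly_transitive (local_algebra A (class_sup C)) (\<psi> C ` carrier T)"
      using C by (simp add: weakly_transitive_def image trans_classes_component)
  next
    fix C
    assume "strongly_effective A (\<rho> ` carrier T)" "C \<in> tclasses"
    then show "strongly_transitive (local_algebra A (class_sup C)) (\<psi> C ` carrier T)"
      by (simp add: image strongly_transitive_component S_def[symmetric])
  qed (use schein equiv in \<open>simp_all add: \<Psi>_def\<close>)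
qed

end
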